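(* Let $\mathsf{H}$ be a quaternionic Hilbert space, let $T\in\mathfrak{B}(\mathsf{H})$ be a normal operator and let $\imath\in\mathbb{S}$. Suppose that $T$ decomposes as $T=A+JB$, where $A$ and $B$ are self-adjoint operators in $\mathfrak{B}(\mathsf{H})$ and $J\in\mathfrak{B}(\mathsf{H})$ is an anti self-adjoint and unitary operator commuting with $A$ and $B$. Then there exists a left scalar multiplication $\mathbb{H}\ni q\mapsto L_q$ of $\mathsf{H}$ such that $L_\imath=J$ and, for every $q\in\mathbb{H}$, $L_qA=AL_q$ and $L_qB=BL_q$.
   Context: $\mathbb{H}$ denotes the quaternions, with conjugation $q\mapsto\overline q$; $\mathbb{S}=\{q\in\mathbb{H}:q^2=-1\}$. A quaternionic Hilbert space $\mathsf{H}$ is a nonzero right $\mathbb{H}$-module with a scalar product $\langle\cdot|\cdot\rangle$ valued in $\mathbb{H}$, right $\mathbb{H}$-linear in the second argument, with $\langle u|v\rangle=\overline{\langle v|u\rangle}$, $\langle u|u\rangle\ge0$ (zero only for $u=0$), complete for $\|u\|=\sqrt{\langle u|u\rangle}$. $\mathfrak{B}(\mathsf{H})$: everywhere defined bounded right $\mathbb{H}$-linear operators; $T^*$ adjoint. Normal: $TT^*=T^*T$; self-adjoint: $A^*=A$; anti self-adjoint: $J^*=-J$; unitary: $J^*J=JJ^*=\mathrm{I}$. A Hilbert basis $N$ of $\mathsf{H}$ is an orthonormal set whose right $\mathbb{H}$-linear span is dense. The left scalar multiplication of $\mathsf{H}$ induced by $N$ is the map $\mathbb{H}\ni q\mapsto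 L_q\in\mathfrak{B}(\mathsf{H})$, $L_qu:=\sum_{z\in N}zq\langle z|u\rangle$; a left scalar multiplication of $\mathsf{H}$ is one induced by some Hilbert basis. *)

theory Defs
  imports "HOL-Analysis.Analysis"
begin

section \<open>Quaternions\<close>

codatatype quat = Quat (q_re: real) (q_i: real) (q_j: real) (q_k: real)

lemma quat_eqI [intro?]:
  "q_re p = q_re q \<Longrightarrow> q_i p = q_i q \<Longrightarrow> q_j p = q_j q \<Longrightarrow> q_k p = q_k q \<Longrightarrow> p = q"
  by (rule quat.expand) simp

lemma quat_eq_iff:
  "p = q \<longleftrightarrow> q_re p = q_re q \<and> q_i p = q_i q \<and> q_j p = q_j q \<and> q_k p = q_k q"
  by (auto intro: quat_eqI)

instantiation quat :: real_algebra_1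
begin

primcorec zero_quat where
  "q_re 0 = 0" | "q_i 0 = 0" | "q_j 0 = 0" | "q_k 0 = 0"

primcorec one_quat where
  "q_re 1 = 1" | "q_i 1 = 0" | "q_j 1 = 0" | "q_k 1 = 0"

primcorec plus_quat where
  "q_re (p + q) = q_re p + q_re q"
| "q_i (p + q) = q_i p + q_i q"
| "q_j (p + q) = q_j p + q_j q"
| "q_k (p + q) = q_k p + q_k q"

primcorec uminus_quat where
  "q_re (- q) = - q_re q"
| "q_i (- q) = - q_i q"
| "q_j (- q) = - q_j q"
| "q_k (- q) = - q_k q"

primcorec minus_quat where
  "q_re (p - q) = q_re p - q_re q"
| "q_i (p - q) = q_i p - q_i q"
| "q_j (p - q) = q_j p - q_j q"
| "q_k (p - q) = q_k p - q_k q"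

primcorec times_quat where
  "q_re (p * q) = q_re p * q_re q - q_i p * q_i q - q_j p * q_j q - q_k p * q_k q"
| "q_i (p * q) = q_re p * q_i q + q_i p * q_re q + q_j p * q_k q - q_k p * q_j q"
| "q_j (p * q) = q_re p * q_j q - q_i p * q_k q + q_j p * q_re q + q_k p * q_i q"
| "q_k (p * q) = q_re p * q_k q + q_i p * q_j q - q_j p * q_i q + q_k p * q_re q"

primcorec scaleR_quat where
  "q_re (scaleR r q) = r * q_re q"
| "q_i (scaleR r q) = r * q_i q"
| "q_j (scaleR r q) = r * q_j q"
| "q_k (scaleR r q) = r * q_k q"

instance
  by standard (simp_all add: quat_eq_iff algebra_simps)

end

primcorec q_cnj :: "quat \<Rightarrow> quat" where
  "q_re (q_cnj q) = q_re q"
| "q_i (q_cnj q) = - q_i q"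
| "q_j (q_cnj q) = - q_j q"
| "q_k (q_cnj q) = - q_k q"

definition imag_units :: "quat set" where
  "imag_units = {q. q\<^sup>2 = - 1}"


section \<open>Quaternionic Hilbert spaces\<close>

text \<open>
  The real vector space structure and the norm of \<^class>\<open>banach\<close> add no data or assumptions: the
  real scaling is the restriction of the right quaternionic one, and the norm is the one induced by
  the scalar product, so that \<^class>\<open>banach\<close> only contributes completeness.
  By \<open>q_inner_commute\<close> the quaternion \<open>\<langle>u | u\<rangle>\<close> is real, so that its being nonnegative is a
  condition on its real part.
\<close>

class quat_hilbert_space = banach +
  fixes r_scale :: "'a \<Rightarrow> quat \<Rightarrow> 'a" (infixl \<open>\<cdot>\<close> 75)
    and q_inner :: "'a \<Rightarrow> 'a \<Rightarrow> quat" (\<open>\<langle>_ | _\<rangle>\<close>)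
  assumes nonzero: "\<exists>u. u \<noteq> 0"
    and r_scale_add_left: "(u + v) \<cdot> q = u \<cdot> q + v \<cdot> q"
    and r_scale_add_right: "u \<cdot> (p + q) = u \<cdot> p + u \<cdot> q"
    and r_scale_mult: "u \<cdot> (p * q) = u \<cdot> p \<cdot> q"
    and r_scale_one: "u \<cdot> 1 = u"
    and scaleR_eq_r_scale: "r *\<^sub>R u = u \<cdot> of_real r"
    and q_inner_add_right: "\<langle>u | v + w\<rangle> = \<langle>u | v\<rangle> + \<langle>u | w\<rangle>"
    and q_inner_r_scale_right: "\<langle>u | v \<cdot> q\<rangle> = \<langle>u | v\<rangle> * q"
    and q_inner_commute: "\<langle>u | v\<rangle> = q_cnj \<langle>v | u\<rangle>"
    and q_inner_ge_zero: "0 \<le> q_re \<langle>u | u\<rangle>"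
    and q_inner_eq_zero: "\<langle>u | u\<rangle> = 0 \<Longrightarrow> u = 0"
    and norm_eq_sqrt_q_inner: "norm u = sqrt (q_re \<langle>u | u\<rangle>)"


section \<open>Bounded operators\<close>

definition bounded_ops :: "('a::quat_hilbert_space \<Rightarrow> 'a) set" where
  "bounded_ops = {T. bounded_linear T \<and> (\<forall>u q. T (u \<cdot> q) = T u \<cdot> q)}"

text \<open>
  The description is unique since the scalar product is definite; for \<open>T \<in> bounded_ops\<close> the
  adjoint exists by the Riesz representation theorem.
\<close>

definition q_adjoint :: "('a::quat_hilbert_space \<Rightarrow> 'a) \<Rightarrow> 'a \<Rightarrow> 'a" where
  "q_adjoint T = (THE S. \<forall>u v. \<langle>S u | v\<rangle> = \<langle>u | T v\<rangle>)"

definition normal_op :: "('a::quat_hilbert_space \<Rightarrow> 'a) \<Rightarrow> bool" where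
  "normal_op T \<longleftrightarrow> T \<circ> q_adjoint T = q_adjoint T \<circ> T"

definition self_adjoint_op :: "('a::quat_hilbert_space \<Rightarrow> 'a) \<Rightarrow> bool" where
  "self_adjoint_op A \<longleftrightarrow> q_adjoint A = A"

definition anti_self_adjoint_op :: "('a::quat_hilbert_space \<Rightarrow> 'a) \<Rightarrow> bool" where
  "anti_self_adjoint_op J \<longleftrightarrow> q_adjoint J = (\<lambda>u. - J u)"

definition unitary_op :: "('a::quat_hilbert_space \<Rightarrow> 'a) \<Rightarrow> bool" where
  "unitary_op J \<longleftrightarrow> q_adjoint J \<circ> J = id \<and> J \<circ> q_adjoint J = id"


section \<open>Hilbert bases and left scalar multiplications\<close>

definition right_span :: "'a::quat_hilbert_space set \<Rightarrow> 'a set" where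
  "right_span N = {\<Sum>z\<in>F. z \<cdot> c z | F c. finite F \<and> F \<subseteq> N}"

definition hilbert_basis :: "'a::quat_hilbert_space set \<Rightarrow> bool" where
  "hilbert_basis N \<longleftrightarrow>
     (\<forall>z\<in>N. \<forall>w\<in>N. \<langle>z | w\<rangle> = (if z = w then 1 else 0)) \<and> closure (right_span N) = UNIV"

text \<open>
  The defining series runs over the possibly uncountable set \<open>N\<close> and is read as an unordered sum;
  its convergence is part of the definition.
\<close>

definition induced_left_mult ::
    "'a::quat_hilbert_space set \<Rightarrow> (quat \<Rightarrow> 'a \<Rightarrow> 'a) \<Rightarrow> bool" where
  "induced_left_mult N L \<longleftrightarrow>
     (\<forall>q. L q \<in> bounded_ops \<and> (\<forall>u. ((\<lambda>z. z \<cdot> q \<cdot> \<langle>z | u\<rangle>) has_sum L q u) N))"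

definition left_scalar_mult :: "(quat \<Rightarrow> 'a::quat_hilbert_space \<Rightarrow> 'a) \<Rightarrow> bool" where
  "left_scalar_mult L \<longleftrightarrow> (\<exists>N. hilbert_basis N \<and> induced_left_mult N L)"

end

(*
  Let E be the set of all u with J u = u i, where i is the given imaginary unit; A and B act on E as
  commuting self-adjoint operators, because normality of A + J B forces A B = B A.  A left scalar
  multiplication as required comes from an orthonormal basis of a closed real subspace K of E that
  is invariant under A and B, on which the scalar product is real, and whose orthogonal complement
  vanishes: A and B then have real matrix entries, and real quaternions are central.  A maximal
  invariant subset of E with real scalar products is such a K.  If v in E were orthogonal to it, it
  could be enlarged by the orbit of v under the monoid generated by A and B, whose elements have
  real scalar products since the operators are symmetric and commute.
*)
theory Submission
  imports Defs
begin

section \<open>The normed algebra of quaternions\<close>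

text \<open>With a topology on the quaternions, right scaling and the scalar product become bounded
  bilinear maps, so unordered sums can be moved through them.\<close>

instantiation quat :: real_normed_algebra_1
begin

definition norm_quat where
  "norm_quat q = sqrt ((q_re q)\<^sup>2 + (q_i q)\<^sup>2 + (q_j q)\<^sup>2 + (q_k q)\<^sup>2)"

definition sgn_quat :: "quat \<Rightarrow> quat" where
  "sgn_quat q = q /\<^sub>R norm q"

definition dist_quat :: "quat \<Rightarrow> quat \<Rightarrow> real" where
  "dist_quat p q = norm (p - q)"

definition uniformity_quat :: "(quat \<times> quat) filter" where
  "uniformity_quat = (INF e\<in>{0 <..}. principal {(x, y). dist x y < e})"

definition open_quat :: "quat set \<Rightarrow> bool" where
  "open_quat U \<longleftrightarrow> (\<forall>x\<in>U. eventually (\<lambda>(x', y). x' = x \<longrightarrow> y \<in> U) uniformity)"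

instance
proof
  fix r :: real and p q :: quat
  show "(norm q = 0) = (q = 0)"
    by (auto simp: norm_quat_def quat_eq_iff add_nonneg_eq_0_iff)
  \<comment> \<open>The norm is the Euclidean norm of a pair of complex numbers, from which the
    triangle inequality is inherited.\<close>
  have pair: "norm q = norm (Complex (q_re q) (q_i q), Complex (q_j q) (q_k q))" for q
    by (simp add: norm_quat_def norm_prod_def complex_norm add_ac)
  show "norm (p + q) \<le> norm p + norm q"
    using norm_triangle_ineq[of "(Complex (q_re p) (q_i p), Complex (q_j p) (q_k p))"
        "(Complex (q_re q) (q_i q), Complex (q_j q) (q_k q))"]
    by (simp add: pair complex_add)
  show "norm (r *\<^sub>R q) = \<bar>r\<bar> * norm q"
    by (simp add: norm_quat_def power_mult_distrib real_sqrt_mult flip: distrib_left)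
  show "norm (p * q) \<le> norm p * norm q"
    unfolding norm_quat_def real_sqrt_mult [symmetric]
    by (rule real_sqrt_le_mono) (simp add: power2_eq_square algebra_simps)
  show "norm (1 :: quat) = 1"
    by (simp add: norm_quat_def)
qed (rule sgn_quat_def dist_quat_def open_quat_def uniformity_quat_def)+

end

text \<open>Euler's four-square identity, under the square root.\<close>

lemma norm_quat_mult: "norm (p * q) = norm p * norm (q :: quat)"
  unfolding norm_quat_def real_sqrt_mult [symmetric]
  by (rule arg_cong[where f = sqrt]) (simp add: power2_eq_square algebra_simps)

lemma q_cnj_0 [simp]: "q_cnj 0 = 0"
  and q_cnj_add: "q_cnj (p + q) = q_cnj p + q_cnj q"
  and q_cnj_mult: "q_cnj (p * q) = q_cnj q * q_cnj p"
  and q_cnj_scaleR: "q_cnj (r *\<^sub>R q) = r *\<^sub>R q_cnj q"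
  by (simp_all add: quat_eq_iff)

lemma of_real_quat_sel [simp]:
  "q_re (of_real r) = r" "q_i (of_real r) = 0" "q_j (of_real r) = 0" "q_k (of_real r) = 0"
  by (simp_all add: of_real_def)

lemma q_cnj_mult_self: "q_cnj q * q = of_real ((norm q)\<^sup>2)"
  by (simp add: quat_eq_iff norm_quat_def) (simp add: power2_eq_square)

lemma Reals_quat_iff: "q \<in> \<real> \<longleftrightarrow> q_i q = 0 \<and> q_j q = 0 \<and> q_k q = 0"
proof
  assume "q_i q = 0 \<and> q_j q = 0 \<and> q_k q = 0"
  then have "q = of_real (q_re q)"
    by (simp add: quat_eq_iff)
  then show "q \<in> \<real>"
    by (metis Reals_of_real)
qed (auto elim: Reals_cases)

lemma Reals_quat_commute: "q \<in> \<real> \<Longrightarrow> p * q = q * (p :: quat)"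
  by (auto simp: Reals_quat_iff quat_eq_iff)

lemma bounded_linear_quat_sel:
  "bounded_linear q_re" "bounded_linear q_i" "bounded_linear q_j" "bounded_linear q_k"
  by (rule bounded_linear_intro[where K = 1];
      simp add: norm_quat_def real_le_rsqrt flip: real_sqrt_abs)+

lemma closed_Reals_quat: "closed (\<real> :: quat set)"
proof -
  have "(\<real> :: quat set) = q_i -` {0} \<inter> q_j -` {0} \<inter> q_k -` {0}"
    by (auto simp: Reals_quat_iff)
  moreover have "closed (f -` {0})" if "bounded_linear f" for f :: "quat \<Rightarrow> real"
    using that by (intro continuous_closed_vimage linear_continuous_at) auto
  ultimately show ?thesis
    using bounded_linear_quat_sel by (metis closed_Int)
qed

lemma imag_unit_not_central:
  assumes "\<iota> \<in> imag_units"
  obtains q where "q * \<iota> \<noteq> \<iota> * q"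
proof -
  have "\<iota> \<notin> \<real>"
  proof
    assume "\<iota> \<in> \<real>"
    then obtain r where "\<iota> = of_real r"
      by (rule Reals_cases)
    then have "r\<^sup>2 = - 1"
      using assms by (auto simp: imag_units_def quat_eq_iff power2_eq_square)
    then show False
      by (metis neg_0_le_iff_le not_one_le_zero zero_le_power2)
  qed
  \<comment> \<open>Commuting with the unit i kills the j and k coordinates, commuting with the unit
    j kills the i and k coordinates; both together would make \<open>\<iota>\<close> real.\<close>
  then have "Quat 0 1 0 0 * \<iota> \<noteq> \<iota> * Quat 0 1 0 0 \<or> Quat 0 0 1 0 * \<iota> \<noteq> \<iota> * Quat 0 0 1 0"
    by (auto simp: Reals_quat_iff quat_eq_iff)
  then show ?thesis
    using that by blast
qed


section \<open>The quaternionic scalar product\<close>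

lemma q_inner_add_left: "\<langle>u + v | w\<rangle> = \<langle>u | w\<rangle> + \<langle>v | w\<rangle>"
  by (metis q_inner_add_right q_inner_commute q_cnj_add)

lemma q_inner_r_scale_left: "\<langle>u \<cdot> q | v\<rangle> = q_cnj q * \<langle>u | v\<rangle>"
  by (metis q_inner_r_scale_right q_inner_commute q_cnj_mult)

lemma q_inner_scaleR_right: "\<langle>u | r *\<^sub>R v\<rangle> = r *\<^sub>R \<langle>u | v\<rangle>"
  by (simp add: scaleR_eq_r_scale q_inner_r_scale_right of_real_def)

lemma q_inner_scaleR_left: "\<langle>r *\<^sub>R u | v\<rangle> = r *\<^sub>R \<langle>u | v\<rangle>"
  by (metis q_inner_scaleR_right q_inner_commute q_cnj_scaleR)

lemma q_inner_self: "\<langle>u | u\<rangle> = of_real ((norm u)\<^sup>2)"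
proof -
  have "\<langle>u | u\<rangle> = q_cnj \<langle>u | u\<rangle>"
    by (rule q_inner_commute)
  then show ?thesis
    using q_inner_ge_zero[of u] by (simp add: quat_eq_iff norm_eq_sqrt_q_inner)
qed

lemma power2_norm_eq_q_inner: "(norm u)\<^sup>2 = q_re \<langle>u | u\<rangle>"
  by (simp add: q_inner_self del: of_real_power)

text \<open>\<open>\<langle>u | u\<rangle>\<close> is real, hence central, and can be pulled out
  from between \<open>q_cnj q\<close> and \<open>q\<close>.\<close>

lemma norm_r_scale: "norm (u \<cdot> q) = norm u * norm q"
proof -
  have "\<langle>u \<cdot> q | u \<cdot> q\<rangle> = q_cnj q * (\<langle>u | u\<rangle> * q)"
    by (simp add: q_inner_r_scale_left q_inner_r_scale_right mult.assoc)
  also have "\<dots> = (q_cnj q * q) * \<langle>u | u\<rangle>"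
    by (metis Reals_of_real Reals_quat_commute mult.assoc q_inner_self)
  also have "\<dots> = of_real ((norm u * norm q)\<^sup>2)"
    by (simp add: q_cnj_mult_self q_inner_self power_mult_distrib Reals_quat_commute)
  finally have "(norm (u \<cdot> q))\<^sup>2 = (norm u * norm q)\<^sup>2"
    unfolding power2_norm_eq_q_inner by (simp del: of_real_power of_real_mult)
  then show ?thesis
    by (simp add: power2_eq_iff_nonneg)
qed

lemma bounded_bilinear_r_scale:
  "bounded_bilinear ((\<cdot>) :: 'a::quat_hilbert_space \<Rightarrow> quat \<Rightarrow> 'a)"
proof
  fix u :: 'a and q :: quat and r :: real
  show "(r *\<^sub>R u) \<cdot> q = r *\<^sub>R (u \<cdot> q)"
    unfolding scaleR_eq_r_scale by (metis Reals_of_real Reals_quat_commute r_scale_mult)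
  show "u \<cdot> (r *\<^sub>R q) = r *\<^sub>R (u \<cdot> q)"
    unfolding scaleR_eq_r_scale
    by (metis Reals_of_real Reals_quat_commute r_scale_mult scaleR_conv_of_real)
  show "\<exists>K. \<forall>u q. norm ((u :: 'a) \<cdot> q) \<le> norm u * norm q * K"
    by (rule exI[of _ 1]) (simp add: norm_r_scale)
qed (rule r_scale_add_left r_scale_add_right)+

interpretation r_scale: bounded_bilinear "(\<cdot>) :: 'a::quat_hilbert_space \<Rightarrow> quat \<Rightarrow> 'a"
  by (rule bounded_bilinear_r_scale)

text \<open>The Cauchy-Schwarz inequality: \<open>w\<close> is \<open>v\<close> minus its projection
  on \<open>u\<close>, and its squared norm is nonnegative. The coefficient \<open>c\<close> has to
  act from the right.\<close>

lemma norm_q_inner_le: "norm \<langle>u | v\<rangle> \<le> norm u * norm v"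
proof (cases "u = 0")
  case True
  then show ?thesis
    using q_inner_scaleR_left[of 0 u v] by simp
next
  case False
  define t where "t = (norm u)\<^sup>2"
  have t: "t > 0"
    using False by (simp add: t_def)
  define c where "c = - (\<langle>u | v\<rangle> /\<^sub>R t)"
  define w where "w = v + u \<cdot> c"
  have "\<langle>u | w\<rangle> = \<langle>u | v\<rangle> + t *\<^sub>R c"
    by (simp add: w_def t_def q_inner_add_right q_inner_r_scale_right q_inner_self scaleR_conv_of_real)
  then have "\<langle>u | w\<rangle> = 0"
    using t by (simp add: c_def)
  then have "\<langle>w | w\<rangle> = \<langle>v | w\<rangle>"
    by (subst (1) w_def) (simp add: q_inner_add_left q_inner_r_scale_left)
  also have "\<dots> = \<langle>v | v\<rangle> - (q_cnj \<langle>u | v\<rangle> * \<langle>u | v\<rangle>) /\<^sub>R t"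
    by (simp add: w_def c_def q_inner_add_right q_inner_r_scale_right flip: q_inner_commute)
  finally have "q_re \<langle>w | w\<rangle> = q_re \<langle>v | v\<rangle> - q_re ((q_cnj \<langle>u | v\<rangle> * \<langle>u | v\<rangle>) /\<^sub>R t)"
    by simp
  then have "(norm w)\<^sup>2 = (norm v)\<^sup>2 - (norm \<langle>u | v\<rangle>)\<^sup>2 / t"
    by (simp add: q_cnj_mult_self q_inner_self divide_inverse mult.commute del: of_real_power times_quat.sel)
  then have "(norm \<langle>u | v\<rangle>)\<^sup>2 / t \<le> (norm v)\<^sup>2"
    by (smt (verit) zero_le_power2)
  then have "(norm \<langle>u | v\<rangle>)\<^sup>2 \<le> (norm u * norm v)\<^sup>2"
    using t by (simp add: divide_le_eq power_mult_distrib mult.commute flip: t_def)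
  then show ?thesis
    by (rule power2_le_imp_le) simp
qed

lemma bounded_bilinear_q_inner:
  "bounded_bilinear (q_inner :: 'a::quat_hilbert_space \<Rightarrow> 'a \<Rightarrow> quat)"
proof
  show "\<exists>K. \<forall>u v. norm \<langle>u :: 'a | v\<rangle> \<le> norm u * norm v * K"
    by (rule exI[of _ 1]) (simp add: norm_q_inner_le)
qed (rule q_inner_add_left q_inner_add_right q_inner_scaleR_left q_inner_scaleR_right)+

interpretation q_inner: bounded_bilinear "q_inner :: 'a::quat_hilbert_space \<Rightarrow> 'a \<Rightarrow> quat"
  by (rule bounded_bilinear_q_inner)

lemma q_inner_eq_zero_sym: "\<langle>u | v\<rangle> = 0 \<longleftrightarrow> \<langle>v | u\<rangle> = 0"
  by (metis q_inner_commute q_cnj_0)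

lemma q_inner_Reals_sym: "\<langle>u | v\<rangle> \<in> \<real> \<longleftrightarrow> \<langle>v | u\<rangle> \<in> \<real>"
  by (subst q_inner_commute) (simp add: Reals_quat_iff)

lemma q_inner_ext:
  assumes "\<And>w. \<langle>u | w\<rangle> = \<langle>v | w\<rangle>"
  shows "u = v"
  using assms[of "u - v"] q_inner_eq_zero[of "u - v"] by (simp add: q_inner.diff_left)


section \<open>Orthonormal sets\<close>

text \<open>The first clause of \<open>hilbert_basis\<close>, separated from density, which comes
  last, through Fourier expansions.\<close>

definition orthonormal :: "'a::quat_hilbert_space set \<Rightarrow> bool" where
  "orthonormal N \<longleftrightarrow> (\<forall>z\<in>N. \<forall>w\<in>N. \<langle>z | w\<rangle> = (if z = w then 1 else 0))"

lemma q_inner_orthonormal_sum: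
  assumes "orthonormal N" "finite F" "F \<subseteq> N" "z \<in> N"
  shows "\<langle>z | \<Sum>w\<in>F. w \<cdot> c w\<rangle> = (if z \<in> F then c z else 0)"
proof -
  have "\<langle>z | \<Sum>w\<in>F. w \<cdot> c w\<rangle> = (\<Sum>w\<in>F. if w = z then c z else 0)"
    unfolding q_inner.sum_right q_inner_r_scale_right
    using assms by (intro sum.cong) (auto simp: orthonormal_def)
  then show ?thesis
    using assms by simp
qed

lemma power2_norm_orthonormal_sum:
  assumes "orthonormal N" "finite F" "F \<subseteq> N"
  shows "(norm (\<Sum>z\<in>F. z \<cdot> c z))\<^sup>2 = (\<Sum>z\<in>F. (norm (c z))\<^sup>2)"
proof -
  define s where "s = (\<Sum>z\<in>F. z \<cdot> c z)"
  have "\<langle>s | s\<rangle> = (\<Sum>z\<in>F. q_cnj (c z) * \<langle>z | s\<rangle>)"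
    by (subst (1) s_def) (simp add: q_inner.sum_left q_inner_r_scale_left)
  also have "\<dots> = (\<Sum>z\<in>F. of_real ((norm (c z))\<^sup>2))"
    using assms unfolding s_def
    by (intro sum.cong) (auto simp: q_inner_orthonormal_sum[OF assms] q_cnj_mult_self
        simp del: of_real_power)
  finally have "of_real ((norm s)\<^sup>2) = (of_real (\<Sum>z\<in>F. (norm (c z))\<^sup>2) :: quat)"
    by (simp add: q_inner_self)
  then show ?thesis
    unfolding s_def of_real_eq_iff .
qed

text \<open>Bessel's inequality for the adjoint of \<open>T\<close> at \<open>u\<close>, phrased
  without the adjoint because it serves to construct it. The vector \<open>s\<close> is chosen so
  that \<open>\<langle>T s | u\<rangle>\<close> is its own squared norm; Cauchy-Schwarz then bounds
  \<open>norm s\<close>.\<close>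

lemma bessel_inequality_op:
  assumes N: "orthonormal N" and F: "finite F" "F \<subseteq> N" and T: "T \<in> bounded_ops"
  shows "(\<Sum>z\<in>F. (norm \<langle>T z | u\<rangle>)\<^sup>2) \<le> (onorm T * norm u)\<^sup>2"
proof -
  interpret T: bounded_linear T
    using T by (simp add: bounded_ops_def)
  have T_scale: "T (v \<cdot> q) = T v \<cdot> q" for v q
    using T by (simp add: bounded_ops_def)
  define s where "s = (\<Sum>z\<in>F. z \<cdot> \<langle>T z | u\<rangle>)"
  have s: "(norm s)\<^sup>2 = (\<Sum>z\<in>F. (norm \<langle>T z | u\<rangle>)\<^sup>2)"
    unfolding s_def by (rule power2_norm_orthonormal_sum[OF N F])
  have "\<langle>T s | u\<rangle> = of_real ((norm s)\<^sup>2)"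
    unfolding s
    by (simp add: s_def T.sum T_scale q_inner.sum_left q_inner_r_scale_left q_cnj_mult_self)
  then have "norm \<langle>T s | u\<rangle> = (norm s)\<^sup>2"
    by (simp del: of_real_power)
  moreover have "norm \<langle>T s | u\<rangle> \<le> onorm T * norm s * norm u"
    by (rule order_trans[OF norm_q_inner_le])
      (simp add: mult_right_mono onorm[OF T.bounded_linear_axioms])
  ultimately have "norm s * norm s \<le> norm s * (onorm T * norm u)"
    by (simp add: power2_eq_square mult_ac)
  then have "norm s \<le> onorm T * norm u"
    using onorm_pos_le[OF T.bounded_linear_axioms] by (cases "s = 0") auto
  then show ?thesis
    unfolding s [symmetric] by (simp add: power_mono)
qed

lemma bessel_inequality:
  fixes u :: "'a::quat_hilbert_space"
  assumes "orthonormal N" "finite F" "F \<subseteq> N"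
  shows "(\<Sum>z\<in>F. (norm \<langle>z | u\<rangle>)\<^sup>2) \<le> (norm u)\<^sup>2"
proof -
  have "id \<in> (bounded_ops :: ('a \<Rightarrow> 'a) set)"
    by (simp add: bounded_ops_def id_def bounded_linear_ident)
  note bessel_inequality_op[OF assms this, of u]
  also have "(onorm (id :: 'a \<Rightarrow> 'a) * norm u)\<^sup>2 \<le> (1 * norm u)\<^sup>2"
    unfolding id_def
    by (intro power_mono mult_right_mono onorm_id_le mult_nonneg_nonneg norm_ge_zero
        onorm_pos_le bounded_linear_ident)
  finally show ?thesis
    by simp
qed

text \<open>By Pythagoras the tails of the vector series are controlled by those of the real series,
  so the partial sums are Cauchy along the finite subsets of \<open>N\<close>, and completeness
  gives the limit.\<close>

lemma orthonormal_summable: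
  fixes N :: "'a::quat_hilbert_space set"
  assumes N: "orthonormal N" and c: "(\<lambda>z. (norm (c z))\<^sup>2) summable_on N"
  shows "(\<lambda>z. z \<cdot> c z) summable_on N"
proof -
  define f where "f z = z \<cdot> c z" for z
  define g where "g z = (norm (c z))\<^sup>2" for z
  obtain L where lim: "(sum g \<longlongrightarrow> L) (finite_subsets_at_top N)"
    using c unfolding has_sum_def summable_on_def g_def by blast
  have "cauchy_filter (filtermap (sum f) (finite_subsets_at_top N))"
    unfolding cauchy_filter_metric_filtermap
  proof (intro allI impI)
    fix e :: real
    assume e: "e > 0"
    \<comment> \<open>The square matches Pythagoras; the further half is there because a tail
      compares two partial sums with \<open>L\<close>.\<close>
    have "eventually (\<lambda>F. dist (sum g F) L < (e/2)\<^sup>2 / 2) (finite_subsets_at_top N)"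
      by (rule tendstoD[OF lim]) (use e in simp)
    then obtain F\<^sub>0 where F0: "finite F\<^sub>0" "F\<^sub>0 \<subseteq> N"
      and close: "\<And>F. finite F \<Longrightarrow> F\<^sub>0 \<subseteq> F \<Longrightarrow> F \<subseteq> N \<Longrightarrow> dist (sum g F) L < (e/2)\<^sup>2 / 2"
      unfolding eventually_finite_subsets_at_top by metis
    have near: "dist (sum f F) (sum f F\<^sub>0) < e/2" if F: "finite F" "F\<^sub>0 \<subseteq> F" "F \<subseteq> N" for F
    proof -
      have "(norm (sum f (F - F\<^sub>0)))\<^sup>2 = sum g (F - F\<^sub>0)"
        unfolding f_def g_def using F by (intro power2_norm_orthonormal_sum[OF N]) auto
      also have "\<dots> = sum g F - sum g F\<^sub>0"
        using F by (simp add: sum_diff)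
      also have "\<dots> < (e/2)\<^sup>2"
        using close[OF F] close[OF F0(1) order_refl F0(2)] unfolding dist_real_def by linarith
      finally have "norm (sum f (F - F\<^sub>0)) < e/2"
        by (rule power2_less_imp_less) (use e in simp)
      then show ?thesis
        using F by (simp add: dist_norm sum_diff)
    qed
    define P where "P F \<longleftrightarrow> finite F \<and> F\<^sub>0 \<subseteq> F \<and> F \<subseteq> N" for F
    have "eventually P (finite_subsets_at_top N)"
      unfolding P_def eventually_finite_subsets_at_top using F0 by blast
    moreover have "dist (sum f F) (sum f F') < e" if "P F" "P F'" for F F'
      using that near[of F] near[of F'] dist_triangle_half_l[of "sum f F" "sum f F\<^sub>0" e "sum f F'"]
      unfolding P_def by (simp add: dist_commute)
    ultimately show "\<exists>P. eventually P (finite_subsets_at_top N) \<and>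
        (\<forall>F F'. P F \<and> P F' \<longrightarrow> dist (sum f F) (sum f F') < e)"
      by blast
  qed
  moreover have "complete (UNIV :: 'a set)"
    by (meson Cauchy_convergent UNIV_I complete_def convergent_def)
  ultimately obtain l where "(sum f \<longlongrightarrow> l) (finite_subsets_at_top N)"
    using complete_uniform[where S = UNIV] by (force simp add: filterlim_def)
  then show ?thesis
    unfolding summable_on_def has_sum_def f_def by blast
qed

lemma q_inner_has_sum:
  assumes "(f has_sum s) N"
  shows "((\<lambda>z. \<langle>u | f z\<rangle>) has_sum \<langle>u | s\<rangle>) N"
  using has_sum_bounded_linear[OF q_inner.bounded_linear_right assms] .

lemma q_inner_orthonormal_has_sum:
  assumes N: "orthonormal N" and s: "((\<lambda>z. z \<cdot> c z) has_sum s) N" and z: "z \<in> N"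
  shows "\<langle>z | s\<rangle> = c z"
proof -
  have "((\<lambda>w. \<langle>z | w \<cdot> c w\<rangle>) has_sum c z) N"
    by (rule has_sum_finite_neutralI[where B = "{z}"])
      (use N z in \<open>auto simp: q_inner_r_scale_right orthonormal_def\<close>)
  then show ?thesis
    using has_sum_unique q_inner_has_sum[OF s] by blast
qed

text \<open>The factor \<open>q\<close> lets one statement serve both the Fourier series, at
  \<open>q = 1\<close>, and the series defining a left multiplication.\<close>

lemma fourier_summable:
  assumes N: "orthonormal N"
  shows "(\<lambda>z. z \<cdot> (q * \<langle>z | u\<rangle>)) summable_on N"
proof (rule orthonormal_summable[OF N nonneg_bdd_above_summable_on])
  show "bdd_above (sum (\<lambda>z. (norm (q * \<langle>z | u\<rangle>))\<^sup>2) ` {F. F \<subseteq> N \<and> finite F})"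
  proof (rule bdd_aboveI2)
    fix F
    assume F: "F \<in> {F. F \<subseteq> N \<and> finite F}"
    then have "(\<Sum>z\<in>F. (norm \<langle>z | u\<rangle>)\<^sup>2) \<le> (norm u)\<^sup>2"
      by (intro bessel_inequality[OF N]) auto
    then show "(\<Sum>z\<in>F. (norm (q * \<langle>z | u\<rangle>))\<^sup>2) \<le> (norm q)\<^sup>2 * (norm u)\<^sup>2"
      by (simp add: norm_quat_mult power_mult_distrib mult_left_mono flip: sum_distrib_left)
  qed
qed simp

lemma subspace_has_sum_mem:
  assumes "subspace K" "closed K" "(f has_sum s) N" "\<And>z. z \<in> N \<Longrightarrow> f z \<in> K"
  shows "s \<in> K"
proof (rule Lim_in_closed_set[OF \<open>closed K\<close>])
  show "(sum f \<longlongrightarrow> s) (finite_subsets_at_top N)"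
    using assms(3) by (simp add: has_sum_def)
  show "\<forall>\<^sub>F F in finite_subsets_at_top N. sum f F \<in> K"
    using assms by (intro eventually_finite_subsets_at_top_weakI subspace_sum) auto
qed simp

text \<open>Zorn's lemma; a nonzero \<open>v\<close> violating the last claim could be normalised
  and adjoined. Normalising is a real scaling, so \<open>K\<close> may be a mere real
  subspace.\<close>

lemma exists_maximal_orthonormal:
  fixes K :: "'a::quat_hilbert_space set"
  assumes "subspace K"
  obtains N where "N \<subseteq> K" "orthonormal N"
    "\<And>v. v \<in> K \<Longrightarrow> (\<And>z. z \<in> N \<Longrightarrow> \<langle>z | v\<rangle> = 0) \<Longrightarrow> v = 0"
proof -
  have "\<exists>N\<in>{N. N \<subseteq> K \<and> orthonormal N}. \<forall>X\<in>{N. N \<subseteq> K \<and> orthonormal N}. N \<subseteq> X \<longrightarrow> X = N"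
  proof (rule subset_Zorn')
    fix C
    assume C: "subset.chain {N. N \<subseteq> K \<and> orthonormal N} C"
    have "\<langle>z | w\<rangle> = (if z = w then 1 else 0)" if "z \<in> \<Union>C" "w \<in> \<Union>C" for z w
    proof -
      obtain N where "N \<in> C" "z \<in> N" "w \<in> N"
        using \<open>z \<in> \<Union>C\<close> \<open>w \<in> \<Union>C\<close> C unfolding subset_chain_def by blast
      moreover then have "orthonormal N"
        using C unfolding subset_chain_def by blast
      ultimately show ?thesis
        unfolding orthonormal_def by blast
    qed
    moreover have "\<Union>C \<subseteq> K"
      using C unfolding subset_chain_def by blast
    ultimately show "\<Union>C \<in> {N. N \<subseteq> K \<and> orthonormal N}"
      unfolding orthonormal_def by blast
  qed
  then obtain N where "N \<in> {N. N \<subseteq> K \<and> orthonormal N}"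
    and max: "\<forall>X\<in>{N. N \<subseteq> K \<and> orthonormal N}. N \<subseteq> X \<longrightarrow> X = N"
    by (rule bexE)
  then have N: "N \<subseteq> K" "orthonormal N"
    by simp_all
  have "v = 0" if v: "v \<in> K" and orth: "\<And>z. z \<in> N \<Longrightarrow> \<langle>z | v\<rangle> = 0" for v
  proof (rule ccontr)
    assume "v \<noteq> 0"
    define w where "w = v /\<^sub>R norm v"
    have w: "w \<in> K"
      using assms v by (simp add: w_def subspace_scale)
    have ww: "\<langle>w | w\<rangle> = 1"
      using \<open>v \<noteq> 0\<close> by (simp add: q_inner_self w_def)
    have zw: "\<langle>z | w\<rangle> = 0" "\<langle>w | z\<rangle> = 0" if "z \<in> N" for z
      using orth[OF that] q_inner_eq_zero_sym[of z v]
      by (auto simp: w_def q_inner.scaleR_left q_inner.scaleR_right)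
    have "orthonormal (insert w N)"
      using N(2) ww zw unfolding orthonormal_def by auto
    then have "insert w N = N"
      using bspec[OF max, of "insert w N"] w N(1) by blast
    then have "w \<in> N"
      by blast
    then show False
      using zw ww by force
  qed
  then show ?thesis
    by (rule that[OF N])
qed

text \<open>The error \<open>u - s\<close> is orthogonal to \<open>N\<close>, but \<open>max\<close>
  applies only inside \<open>K\<close>. Since \<open>K\<close> is only a real subspace,
  \<open>coeffs\<close> is what keeps the partial sums, and hence \<open>s\<close>, in it.\<close>

lemma fourier_expansion:
  assumes K: "subspace K" "closed K" and N: "orthonormal N"
    and max: "\<And>v. v \<in> K \<Longrightarrow> (\<And>z. z \<in> N \<Longrightarrow> \<langle>z | v\<rangle> = 0) \<Longrightarrow> v = 0"
    and u: "u \<in> K" and coeffs: "\<And>z. z \<in> N \<Longrightarrow> z \<cdot> \<langle>z | u\<rangle> \<in> K"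
  shows "((\<lambda>z. z \<cdot> \<langle>z | u\<rangle>) has_sum u) N"
proof -
  obtain s where s: "((\<lambda>z. z \<cdot> \<langle>z | u\<rangle>) has_sum s) N"
    using fourier_summable[OF N, of 1 u] unfolding summable_on_def by auto
  then have "s \<in> K"
    by (rule subspace_has_sum_mem[OF K]) (rule coeffs)
  moreover have "\<langle>z | u - s\<rangle> = 0" if "z \<in> N" for z
    using q_inner_orthonormal_has_sum[OF N s that] by (simp add: q_inner.diff_right)
  ultimately have "u - s = 0"
    using max u K(1) by (meson subspace_diff)
  then show ?thesis
    using s by simp
qed

lemma hilbert_basis_if_expansion:
  assumes N: "orthonormal N" and exp: "\<And>u. ((\<lambda>z. z \<cdot> \<langle>z | u\<rangle>) has_sum u) N"
  shows "hilbert_basis N"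
proof -
  have "u \<in> closure (right_span N)" for u
  proof (rule Lim_in_closed_set[OF closed_closure])
    show "(sum (\<lambda>z. z \<cdot> \<langle>z | u\<rangle>) \<longlongrightarrow> u) (finite_subsets_at_top N)"
      using exp[of u] by (simp add: has_sum_def)
    show "\<forall>\<^sub>F F in finite_subsets_at_top N. (\<Sum>z\<in>F. z \<cdot> \<langle>z | u\<rangle>) \<in> closure (right_span N)"
      by (intro eventually_finite_subsets_at_top_weakI subsetD[OF closure_subset])
        (auto simp: right_span_def)
  qed simp
  then show ?thesis
    using N by (auto simp: hilbert_basis_def orthonormal_def)
qed


section \<open>Adjoints\<close>

text \<open>Without the existence part, the description in \<^const>\<open>q_adjoint\<close> would carry no information.\<close>

lemma q_adjoint_inner:
  fixes T :: "'a::quat_hilbert_space \<Rightarrow> 'a"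
  assumes "T \<in> bounded_ops"
  shows "\<langle>q_adjoint T u | v\<rangle> = \<langle>u | T v\<rangle>"
proof -
  interpret T: bounded_linear T
    using assms by (simp add: bounded_ops_def)
  have T_scale: "T (u \<cdot> q) = T u \<cdot> q" for u q
    using assms by (simp add: bounded_ops_def)
  obtain N :: "'a set" where N: "orthonormal N"
    and max: "\<And>v. (\<And>z. z \<in> N \<Longrightarrow> \<langle>z | v\<rangle> = 0) \<Longrightarrow> v = 0"
    using exists_maximal_orthonormal[OF subspace_UNIV] by (metis UNIV_I)
  have exp: "((\<lambda>z. z \<cdot> \<langle>z | u\<rangle>) has_sum u) N" for u
    using max by (intro fourier_expansion[of UNIV] N) auto
  have "\<exists>w. \<forall>v. \<langle>w | v\<rangle> = \<langle>u | T v\<rangle>" for u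
  proof -
    \<comment> \<open>The numbers \<open>\<langle>T z | u\<rangle>\<close> are the Fourier
      coefficients that the adjoint of \<open>T\<close> must have at \<open>u\<close>. Square
      summability turns them into a vector \<open>w\<close>.\<close>
    have "(\<lambda>z. (norm \<langle>T z | u\<rangle>)\<^sup>2) summable_on N"
    proof (rule nonneg_bdd_above_summable_on)
      show "bdd_above (sum (\<lambda>z. (norm \<langle>T z | u\<rangle>)\<^sup>2) ` {F. F \<subseteq> N \<and> finite F})"
      proof (rule bdd_aboveI2)
        fix F
        assume "F \<in> {F. F \<subseteq> N \<and> finite F}"
        then have F: "finite F" "F \<subseteq> N"
          by auto
        show "(\<Sum>z\<in>F. (norm \<langle>T z | u\<rangle>)\<^sup>2) \<le> (onorm T * norm u)\<^sup>2"
          by (rule bessel_inequality_op[OF N F assms])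
      qed
    qed simp
    from orthonormal_summable[OF N this]
    obtain w where w: "((\<lambda>z. z \<cdot> \<langle>T z | u\<rangle>) has_sum w) N"
      unfolding summable_on_def by blast
    have "\<langle>w | z\<rangle> = \<langle>u | T z\<rangle>" if "z \<in> N" for z
      using q_inner_orthonormal_has_sum[OF N w that] by (metis q_inner_commute)
    then have "((\<lambda>z. \<langle>u | T (z \<cdot> \<langle>z | v\<rangle>)\<rangle>) has_sum \<langle>w | v\<rangle>) N" for v
      using q_inner_has_sum[OF exp[of v], of w]
      by (simp add: T_scale q_inner_r_scale_right cong: has_sum_cong)
    moreover have "((\<lambda>z. \<langle>u | T (z \<cdot> \<langle>z | v\<rangle>)\<rangle>) has_sum \<langle>u | T v\<rangle>) N" for v
      by (intro q_inner_has_sum has_sum_bounded_linear[OF T.bounded_linear_axioms] exp)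
    ultimately show ?thesis
      using has_sum_unique by blast
  qed
  then obtain S where S: "\<And>u v. \<langle>S u | v\<rangle> = \<langle>u | T v\<rangle>"
    by metis
  have "q_adjoint T = S"
    unfolding q_adjoint_def
  proof (rule the_equality)
    fix S'
    assume "\<forall>u v. \<langle>S' u | v\<rangle> = \<langle>u | T v\<rangle>"
    then show "S' = S"
      using S by (intro ext q_inner_ext) simp
  qed (use S in simp)
  then show ?thesis
    using S by simp
qed


section \<open>Real forms invariant under commuting symmetric operators\<close>

text \<open>The orbit of a vector under this monoid is the smallest set that contains it and is
  mapped into itself by \<open>\<A>\<close>; linear combinations and limits are supplied by
  \<open>real_invariant_hull\<close>.\<close>

inductive_set op_monoid :: "('b \<Rightarrow> 'b) set \<Rightarrow> ('b \<Rightarrow> 'b) set" for \<A> where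
  id: "id \<in> op_monoid \<A>"
| comp: "C \<in> \<A> \<Longrightarrow> X \<in> op_monoid \<A> \<Longrightarrow> C \<circ> X \<in> op_monoid \<A>"

lemma op_monoid_commute:
  assumes "X \<in> op_monoid \<A>" "\<forall>C\<in>\<A>. C \<circ> D = D \<circ> C"
  shows "X \<circ> D = D \<circ> X"
  using assms(1)
proof induction
  case (comp C X)
  then show ?case
    using assms(2) by (simp add: fun_eq_iff)
qed simp

lemma op_monoid_invariant:
  assumes "X \<in> op_monoid \<A>" "\<forall>C\<in>\<A>. C ` S \<subseteq> S" "u \<in> S"
  shows "X u \<in> S"
  using assms(1) by induction (use assms in auto)

text \<open>Arbitrary sets are allowed, so that unions of chains and adjoined orbits stay in the
  class; a maximal member turns out to be a closed subspace anyway.\<close>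

definition real_invariant ::
    "('a::quat_hilbert_space \<Rightarrow> 'a) set \<Rightarrow> 'a set \<Rightarrow> bool" where
  "real_invariant \<A> S \<longleftrightarrow> (\<forall>C\<in>\<A>. C ` S \<subseteq> S) \<and> (\<forall>u\<in>S. \<forall>v\<in>S. \<langle>u | v\<rangle> \<in> \<real>)"

lemma real_invariantI:
  assumes "\<And>C u. C \<in> \<A> \<Longrightarrow> u \<in> S \<Longrightarrow> C u \<in> S" "\<And>u v. u \<in> S \<Longrightarrow> v \<in> S \<Longrightarrow> \<langle>u | v\<rangle> \<in> \<real>"
  shows "real_invariant \<A> S"
  using assms unfolding real_invariant_def image_subset_iff by simp

lemma real_invariantD:
  assumes "real_invariant \<A> S"
  shows "C \<in> \<A> \<Longrightarrow> u \<in> S \<Longrightarrow> C u \<in> S" and "u \<in> S \<Longrightarrow> v \<in> S \<Longrightarrow> \<langle>u | v\<rangle> \<in> \<real>"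
  using assms unfolding real_invariant_def by blast+

abbreviation closed_subspace :: "'b::real_normed_vector set \<Rightarrow> bool" where
  "closed_subspace K \<equiv> subspace K \<and> closed K"

lemma closed_subspace_hull: "closed_subspace (closed_subspace hull S)"
  by (rule hull_in) (auto intro: subspace_Inter)

lemma closed_subspace_vimage:
  assumes "bounded_linear f" "closed_subspace K"
  shows "closed_subspace (f -` K)"
  using assms linear_subspace_vimage[of f K]
  by (auto intro: continuous_closed_vimage linear_continuous_at bounded_linear.linear)

lemma closed_subspace_Reals: "closed_subspace (\<real> :: quat set)"
  by (auto simp: closed_Reals_quat subspace_def scaleR_conv_of_real)

text \<open>Both conditions say that \<open>S\<close> lies in preimages of closed subspaces under
  bounded linear maps, and such a preimage contains the hull as soon as it contains
  \<open>S\<close>. For the scalar product this is done one argument at a time, with symmetry in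
  between.\<close>

lemma real_invariant_hull:
  assumes \<A>: "\<A> \<subseteq> bounded_ops" and S: "real_invariant \<A> S"
  shows "real_invariant \<A> (closed_subspace hull S)"
proof -
  let ?K = "closed_subspace hull S"
  have "?K \<subseteq> C -` ?K" if "C \<in> \<A>" for C
  proof (rule hull_minimal)
    show "S \<subseteq> C -` ?K"
      using real_invariantD(1)[OF S that] hull_inc by fastforce
    show "closed_subspace (C -` ?K)"
      using \<A> that by (intro closed_subspace_vimage closed_subspace_hull) (auto simp: bounded_ops_def)
  qed
  moreover have *: "?K \<subseteq> q_inner u -` \<real>" if "S \<subseteq> q_inner u -` \<real>" for u
    using that by (rule hull_minimal)
      (rule closed_subspace_vimage[OF q_inner.bounded_linear_right closed_subspace_Reals])
  have "?K \<subseteq> q_inner u -` \<real>" if "u \<in> S" for u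
    using real_invariantD(2)[OF S that] by (intro *) auto
  then have "S \<subseteq> q_inner u -` \<real>" if "u \<in> ?K" for u
    using that q_inner_Reals_sym by blast
  then have "?K \<subseteq> q_inner u -` \<real>" if "u \<in> ?K" for u
    using that by (intro *)
  ultimately show ?thesis
    unfolding real_invariant_def by blast
qed

text \<open>Moving a word across the scalar product reverses it; commutativity restores the
  order.\<close>

lemma q_inner_op_monoid:
  assumes X: "X \<in> op_monoid \<A>"
    and sym: "\<forall>C\<in>\<A>. \<forall>u v. \<langle>C u | v\<rangle> = \<langle>u | C v\<rangle>"
    and comm: "\<forall>C\<in>\<A>. \<forall>D\<in>\<A>. C \<circ> D = D \<circ> C"
  shows "\<langle>X u | v\<rangle> = \<langle>u | X v\<rangle>"
  using X
proof (induction arbitrary: u v)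
  case (comp C X)
  then show ?case
    using op_monoid_commute[OF comp.hyps(2), of C] sym comm by (simp add: fun_eq_iff)
qed simp

text \<open>For commuting symmetric \<open>X\<close> and \<open>Y\<close> the scalar product \<open>\<langle>X v | Y v\<rangle>\<close> equals its conjugate
  \<open>\<langle>Y v | X v\<rangle>\<close>; so the orbit of any single vector is a legitimate extension.\<close>

lemma real_invariant_Un_orbit:
  assumes sym: "\<forall>C\<in>\<A>. \<forall>u v. \<langle>C u | v\<rangle> = \<langle>u | C v\<rangle>"
    and comm: "\<forall>C\<in>\<A>. \<forall>D\<in>\<A>. C \<circ> D = D \<circ> C"
    and S: "real_invariant \<A> S" and orth: "\<And>u. u \<in> S \<Longrightarrow> \<langle>u | v\<rangle> = 0"
  shows "real_invariant \<A> (S \<union> (\<lambda>X. X v) ` op_monoid \<A>)"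
proof -
  let ?O = "(\<lambda>X. X v) ` op_monoid \<A>"
  have O: "C w \<in> ?O" if "C \<in> \<A>" and w: "w \<in> ?O" for C w
  proof -
    obtain X where X: "X \<in> op_monoid \<A>" "w = X v"
      using w by blast
    then show ?thesis
      using op_monoid.comp[OF that(1) X(1)] by (intro image_eqI[of _ _ "C \<circ> X"]) simp_all
  qed
  have OO: "\<langle>X v | Y v\<rangle> \<in> \<real>" if X: "X \<in> op_monoid \<A>" and Y: "Y \<in> op_monoid \<A>" for X Y
  proof -
    have "\<forall>C\<in>\<A>. C \<circ> Y = Y \<circ> C"
      using op_monoid_commute[OF Y] comm by metis
    then have "X (Y v) = Y (X v)"
      using op_monoid_commute[OF X] by (simp add: fun_eq_iff)
    then have "\<langle>X v | Y v\<rangle> = \<langle>Y v | X v\<rangle>"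
      by (simp add: q_inner_op_monoid[OF X sym comm] q_inner_op_monoid[OF Y sym comm])
    then have "\<langle>X v | Y v\<rangle> = q_cnj \<langle>X v | Y v\<rangle>"
      by (metis q_inner_commute)
    then show ?thesis
      by (simp add: Reals_quat_iff quat_eq_iff)
  qed
  \<comment> \<open>Symmetry moves \<open>X\<close> onto \<open>u\<close>, which stays in
    \<open>S\<close> by invariance.\<close>
  have SO: "\<langle>u | X v\<rangle> = 0" if "u \<in> S" and X: "X \<in> op_monoid \<A>" for u X
  proof -
    have "X u \<in> S"
      using S that by (intro op_monoid_invariant[OF X]) (auto simp: real_invariant_def)
    then show ?thesis
      using orth by (simp add: q_inner_op_monoid[OF X sym comm, symmetric])
  qed
  show ?thesis
  proof (rule real_invariantI)
    fix C w
    assume "C \<in> \<A>" "w \<in> S \<union> ?O"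
    then show "C w \<in> S \<union> ?O"
      using O[of C w] real_invariantD(1)[OF S, of C w] by auto
  next
    fix w w'
    assume *: "w \<in> S \<union> ?O" "w' \<in> S \<union> ?O"
    have mixed: "\<langle>x | y\<rangle> \<in> \<real>" if "x \<in> S" "y \<in> ?O" for x y
      using SO that by auto
    from * show "\<langle>w | w'\<rangle> \<in> \<real>"
      using OO real_invariantD(2)[OF S, of w w'] mixed[of w w'] mixed[of w' w]
        q_inner_Reals_sym[of w w'] by (elim UnE) auto
  qed
qed

text \<open>Maximality from Zorn's lemma is used twice: against the closed hull, which makes
  \<open>K\<close> a closed subspace, and against the orbit of \<open>v\<close>, which puts
  \<open>v\<close> into \<open>K\<close> and thus makes it orthogonal to itself. The assumptions on
  \<open>E\<close> keep both extensions inside \<open>E\<close>.\<close>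

lemma exists_real_form:
  fixes E :: "'a::quat_hilbert_space set"
  assumes \<A>: "\<A> \<subseteq> bounded_ops"
    and sym: "\<forall>C\<in>\<A>. \<forall>u v. \<langle>C u | v\<rangle> = \<langle>u | C v\<rangle>"
    and comm: "\<forall>C\<in>\<A>. \<forall>D\<in>\<A>. C \<circ> D = D \<circ> C"
    and E: "closed_subspace E" and inv: "\<forall>C\<in>\<A>. C ` E \<subseteq> E"
  obtains K where "closed_subspace K" "K \<subseteq> E" "real_invariant \<A> K"
    "\<And>v. v \<in> E \<Longrightarrow> (\<And>u. u \<in> K \<Longrightarrow> \<langle>u | v\<rangle> = 0) \<Longrightarrow> v = 0"
proof -
  let ?F = "{S. S \<subseteq> E \<and> real_invariant \<A> S}"
  have "\<exists>K\<in>?F. \<forall>X\<in>?F. K \<subseteq> X \<longrightarrow> X = K"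
  proof (rule subset_Zorn')
    fix \<C>
    assume chain: "subset.chain ?F \<C>"
    then have "\<C> \<subseteq> ?F"
      unfolding subset_chain_def by blast
    then have inv_S: "real_invariant \<A> S" if "S \<in> \<C>" for S
      using that by auto
    have "real_invariant \<A> (\<Union>\<C>)"
    proof (rule real_invariantI)
      fix C u
      assume "C \<in> \<A>" "u \<in> \<Union>\<C>"
      then show "C u \<in> \<Union>\<C>"
        using real_invariantD(1)[OF inv_S] by (meson Union_iff)
    next
      fix u v
      assume "u \<in> \<Union>\<C>" "v \<in> \<Union>\<C>"
      then obtain S where "S \<in> \<C>" "u \<in> S" "v \<in> S"
        using chain unfolding subset_chain_def by blast
      then show "\<langle>u | v\<rangle> \<in> \<real>"
        using real_invariantD(2)[OF inv_S] by simp
    qed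
    moreover have "\<Union>\<C> \<subseteq> E"
      using \<open>\<C> \<subseteq> ?F\<close> by auto
    ultimately show "\<Union>\<C> \<in> ?F"
      by simp
  qed
  then obtain K where "K \<in> ?F" and max: "\<forall>X\<in>?F. K \<subseteq> X \<longrightarrow> X = K"
    by (rule bexE)
  then have K: "K \<subseteq> E" "real_invariant \<A> K"
    by simp_all
  have "closed_subspace hull K \<in> ?F"
    using real_invariant_hull[OF \<A> K(2)] hull_minimal[of K E closed_subspace] K(1) E by blast
  then have "closed_subspace hull K = K"
    using bspec[OF max] hull_subset by metis
  then have closed: "closed_subspace K"
    using closed_subspace_hull[of K] by simp
  have "v = 0" if v: "v \<in> E" and orth: "\<And>u. u \<in> K \<Longrightarrow> \<langle>u | v\<rangle> = 0" for v
  proof -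
    let ?O = "(\<lambda>X. X v) ` op_monoid \<A>"
    have "real_invariant \<A> (K \<union> ?O)"
      using orth by (rule real_invariant_Un_orbit[OF sym comm K(2)])
    moreover have "?O \<subseteq> E"
      using op_monoid_invariant[OF _ inv v] by blast
    ultimately have "K \<union> ?O = K"
      using bspec[OF max, of "K \<union> ?O"] K(1) by simp
    moreover have "v \<in> ?O"
      by (rule image_eqI[OF _ op_monoid.id]) simp
    ultimately show "v = 0"
      using orth[of v] q_inner_eq_zero[of v] by blast
  qed
  then show ?thesis
    by (rule that[OF closed K])
qed


section \<open>Left scalar multiplications\<close>

text \<open>Bracketed as \<open>z \<cdot> (q * \<langle>z | u\<rangle>)\<close>, the series is an
  orthonormal sum: Pythagoras and Bessel bound its partial sums by \<open>norm u * norm q\<close>,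
  and the bound survives in the limit.\<close>

lemma orthonormal_induced_left_mult:
  fixes N :: "'a::quat_hilbert_space set"
  assumes N: "orthonormal N"
  obtains L where "induced_left_mult N L"
proof -
  define L where "L q u = (\<Sum>\<^sub>\<infinity>z\<in>N. z \<cdot> (q * \<langle>z | u\<rangle>))" for q u
  have L: "((\<lambda>z. z \<cdot> (q * \<langle>z | u\<rangle>)) has_sum L q u) N" for q u
    unfolding L_def by (rule has_sum_infsum[OF fourier_summable[OF N]])
  have add: "L q (u + v) = L q u + L q v" for q u v
    using has_sum_add[OF L[of q u] L[of q v]] L[of q "u + v"] has_sum_unique
    by (simp add: q_inner_add_right distrib_left r_scale_add_right) blast
  have scale: "L q (u \<cdot> p) = L q u \<cdot> p" for q u p
    using has_sum_bounded_linear[OF r_scale.bounded_linear_left L[of q u], of p]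
      L[of q "u \<cdot> p"] has_sum_unique
    by (simp add: q_inner_r_scale_right mult.assoc flip: r_scale_mult) blast
  have bound: "norm (L q u) \<le> norm u * norm q" for q u
  proof -
    have "L q u \<in> cball 0 (norm u * norm q)"
    proof (rule Lim_in_closed_set[OF closed_cball])
      show "(sum (\<lambda>z. z \<cdot> (q * \<langle>z | u\<rangle>)) \<longlongrightarrow> L q u) (finite_subsets_at_top N)"
        using L[of q u] by (simp add: has_sum_def)
      have "norm (\<Sum>z\<in>F. z \<cdot> (q * \<langle>z | u\<rangle>)) \<le> norm u * norm q" if F: "finite F" "F \<subseteq> N" for F
      proof (rule power2_le_imp_le)
        have "(norm q)\<^sup>2 * (\<Sum>z\<in>F. (norm \<langle>z | u\<rangle>)\<^sup>2) \<le> (norm q)\<^sup>2 * (norm u)\<^sup>2"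
          by (intro mult_left_mono bessel_inequality[OF N F]) simp
        then show "(norm (\<Sum>z\<in>F. z \<cdot> (q * \<langle>z | u\<rangle>)))\<^sup>2 \<le> (norm u * norm q)\<^sup>2"
          by (simp add: power2_norm_orthonormal_sum[OF N F] norm_quat_mult power_mult_distrib
              mult.commute flip: sum_distrib_left)
      qed simp
      then show "\<forall>\<^sub>F F in finite_subsets_at_top N.
          (\<Sum>z\<in>F. z \<cdot> (q * \<langle>z | u\<rangle>)) \<in> cball 0 (norm u * norm q)"
        by (intro eventually_finite_subsets_at_top_weakI) simp
    qed simp
    then show ?thesis
      by simp
  qed
  have "bounded_linear (L q)" for q
    by (rule bounded_linear_intro[where K = "norm q"])
      (simp_all add: add bound scaleR_eq_r_scale scale)
  then have "induced_left_mult N L"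
    using L scale by (simp add: induced_left_mult_def bounded_ops_def r_scale_mult)
  then show ?thesis
    by (rule that)
qed

lemma anti_self_adjoint_unitary_square:
  assumes "anti_self_adjoint_op J" "unitary_op J"
  shows "J (J u) = - u"
proof -
  have "(q_adjoint J \<circ> J) u = u"
    using assms(2) by (simp add: unitary_op_def)
  then have "- J (J u) = u"
    using assms(1) by (simp add: anti_self_adjoint_op_def)
  then show ?thesis
    by (metis minus_minus)
qed

text \<open>The adjoint of \<open>T\<close> is \<open>A - J B\<close>, so the commutator of
  \<open>T\<close> with its adjoint is \<open>2 J (B A - A B)\<close>; and \<open>J\<close> is
  injective because its square is minus the identity.\<close>

lemma normal_imp_commuting:
  assumes A: "A \<in> bounded_ops" "self_adjoint_op A"
    and B: "B \<in> bounded_ops" "self_adjoint_op B"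
    and J: "J \<in> bounded_ops" "anti_self_adjoint_op J" "unitary_op J"
    and JA: "\<And>u. J (A u) = A (J u)" and JB: "\<And>u. J (B u) = B (J u)"
    and T: "T = (\<lambda>u. A u + J (B u))" "T \<in> bounded_ops" "normal_op T"
  shows "A (B u) = B (A u)"
proof -
  interpret A: bounded_linear A
    using A by (simp add: bounded_ops_def)
  interpret B: bounded_linear B
    using B by (simp add: bounded_ops_def)
  interpret J: bounded_linear J
    using J by (simp add: bounded_ops_def)
  have "\<langle>q_adjoint T u | v\<rangle> = \<langle>A u - J (B u) | v\<rangle>" for u v
    using q_adjoint_inner[OF T(2), of u v] q_adjoint_inner[OF A(1), of u v]
      q_adjoint_inner[OF B(1), of u "J v"] q_adjoint_inner[OF J(1), of "B u" v]
      A(2) B(2) J(2)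
    by (simp add: T(1) JB self_adjoint_op_def anti_self_adjoint_op_def q_inner_add_right
        q_inner.diff_left q_inner.minus_left)
  then have adj: "q_adjoint T u = A u - J (B u)" for u
    by (rule q_inner_ext)
  have "T (q_adjoint T u) = q_adjoint T (T u)"
    using T(3) unfolding normal_op_def by (metis comp_apply)
  then have "2 *\<^sub>R (J (B (A u)) - J (A (B u))) = 0"
    unfolding adj by (simp add: T(1) A.add A.diff B.add B.diff J.add J.diff JA scaleR_2)
      (simp add: algebra_simps)
  then have "J (J (B (A u))) = J (J (A (B u)))"
    by simp
  then show ?thesis
    by (simp add: anti_self_adjoint_unitary_square[OF J(2,3)])
qed

theorem theorem5p14:
  fixes T A B J :: "'a::quat_hilbert_space \<Rightarrow> 'a" and \<iota> :: quat
  assumes "T \<in> bounded_ops" and "normal_op T"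
    and "\<iota> \<in> imag_units"
    and "A \<in> bounded_ops" and "self_adjoint_op A"
    and "B \<in> bounded_ops" and "self_adjoint_op B"
    and "J \<in> bounded_ops" and "anti_self_adjoint_op J" and "unitary_op J"
    and "J \<circ> A = A \<circ> J" and "J \<circ> B = B \<circ> J"
    and "T = (\<lambda>u. A u + J (B u))"
  shows "\<exists>L :: quat \<Rightarrow> 'a \<Rightarrow> 'a. left_scalar_mult L \<and> L \<iota> = J \<and>
           (\<forall>q. L q \<circ> A = A \<circ> L q \<and> L q \<circ> B = B \<circ> L q)"
proof -
  interpret J: bounded_linear J
    using assms by (simp add: bounded_ops_def)
  have J_scale: "J (u \<cdot> q) = J u \<cdot> q" for u q
    using assms by (simp add: bounded_ops_def)
  have J_square: "J (J u) = - u" for u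
    by (rule anti_self_adjoint_unitary_square[OF assms(9,10)])
  have J_inner: "\<langle>J u | v\<rangle> = - \<langle>u | J v\<rangle>" for u v
    using q_adjoint_inner[OF assms(8), of u v] assms(9)
    by (simp add: anti_self_adjoint_op_def q_inner.minus_left flip: minus_equation_iff)
  have JA: "J (A u) = A (J u)" and JB: "J (B u) = B (J u)" for u
    using assms(11,12) by (metis comp_apply)+
  have \<A>: "{A, B} \<subseteq> bounded_ops"
    using assms by simp
  have sym: "\<forall>C\<in>{A, B}. \<forall>u v. \<langle>C u | v\<rangle> = \<langle>u | C v\<rangle>"
    using assms(5,7) q_adjoint_inner[OF assms(4)] q_adjoint_inner[OF assms(6)]
    by (simp add: self_adjoint_op_def)
  have comm: "\<forall>C\<in>{A, B}. \<forall>D\<in>{A, B}. C \<circ> D = D \<circ> C"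
    using normal_imp_commuting[OF assms(4-10) JA JB assms(13,1,2)] by (simp add: fun_eq_iff)

  \<comment> \<open>A left multiplication at \<open>\<iota>\<close> sends a basis vector
    \<open>z\<close> to \<open>z \<cdot> \<iota>\<close>, so \<open>L \<iota> = J\<close> forces the
    basis into \<open>E\<close>. This is a real subspace, in general not stable under right
    quaternionic scaling.\<close>
  define E where "E = {u. J u = u \<cdot> \<iota>}"
  have "E = (\<lambda>u. J u - u \<cdot> \<iota>) -` {0}"
    by (auto simp: E_def)
  moreover have "closed_subspace ((\<lambda>u. J u - u \<cdot> \<iota>) -` {0})"
    by (intro closed_subspace_vimage bounded_linear_sub J.bounded_linear_axioms
        r_scale.bounded_linear_left) (simp add: subspace_0)
  ultimately have E: "closed_subspace E"
    by simp
  have inv: "\<forall>C\<in>{A, B}. C ` E \<subseteq> E"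
    using \<A> JA JB unfolding E_def bounded_ops_def by auto
  obtain K where K: "closed_subspace K" "K \<subseteq> E" "real_invariant {A, B} K"
    and K_max: "\<And>v. v \<in> E \<Longrightarrow> (\<And>u. u \<in> K \<Longrightarrow> \<langle>u | v\<rangle> = 0) \<Longrightarrow> v = 0"
    using exists_real_form[OF \<A> sym comm E inv] by metis
  have JK: "J k = k \<cdot> \<iota>" if "k \<in> K" for k
    using that K(2) by (auto simp: E_def)

  have \<iota>2: "\<iota> * \<iota> = - 1"
    using assms(3) by (simp add: imag_units_def power2_eq_square)
  \<comment> \<open>\<open>K_max\<close> covers vectors of \<open>E\<close> only; arbitrary vectors
    are brought there by a projection.\<close>
  have K_total: "u = 0" if orth: "\<And>k. k \<in> K \<Longrightarrow> \<langle>k | u\<rangle> = 0" for u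
  proof -
    \<comment> \<open>Up to the factor 2, \<open>w - J w \<cdot> \<iota>\<close> is the projection
      of \<open>w\<close> to \<open>E\<close>. For \<open>w = u \<cdot> q\<close> it remains
      orthogonal to \<open>K\<close>, because \<open>J\<close> is anti self-adjoint and acts on
      \<open>K\<close> as right scaling by \<open>\<iota>\<close>; so it vanishes.\<close>
    have fixed: "u \<cdot> q = J u \<cdot> (q * \<iota>)" for q
    proof -
      let ?v = "u \<cdot> q - J (u \<cdot> q) \<cdot> \<iota>"
      have "?v \<in> E"
        by (simp add: E_def J.diff J_scale J_square r_scale.diff_left r_scale.minus_left
            r_scale.minus_right \<iota>2 r_scale_one flip: r_scale_mult)
          (simp add: mult.assoc \<iota>2 r_scale.minus_right)
      moreover have "\<langle>k | ?v\<rangle> = 0" if "k \<in> K" for k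
      proof -
        have "\<langle>k | J (u \<cdot> q)\<rangle> = - \<langle>k \<cdot> \<iota> | u \<cdot> q\<rangle>"
          using J_inner[of k "u \<cdot> q"] JK[OF that] by simp
        then show ?thesis
          using orth[OF that]
          by (simp add: q_inner.diff_right q_inner_r_scale_left q_inner_r_scale_right)
      qed
      ultimately show ?thesis
        using K_max[of ?v] by (simp add: J_scale r_scale_mult)
    qed
    \<comment> \<open>This is \<open>fixed\<close> at \<open>\<iota>\<close>; at
      \<open>q * \<iota>\<close> it gives \<open>u \<cdot> (q * \<iota>) = - J u \<cdot> q\<close>.
      Hence \<open>u\<close> is annihilated by every commutator of \<open>q\<close> and
      \<open>\<iota>\<close>, and a nonzero one exists.\<close>
    have "u \<cdot> \<iota> = - J u"
      using fixed[of \<iota>] by (simp add: \<iota>2 r_scale.minus_right r_scale_one)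
    then have "u \<cdot> (\<iota> * q) = u \<cdot> (q * \<iota>)" for q
      using fixed[of "q * \<iota>"]
      by (simp add: r_scale_mult r_scale.minus_left)
        (simp add: mult.assoc \<iota>2 r_scale.minus_right r_scale_one flip: r_scale_mult)
    moreover obtain q where "q * \<iota> \<noteq> \<iota> * q"
      using imag_unit_not_central[OF assms(3)] .
    ultimately have "u \<cdot> (q * \<iota> - \<iota> * q) = 0" "q * \<iota> - \<iota> * q \<noteq> 0"
      by (simp_all add: r_scale.diff_right)
    then show "u = 0"
      using norm_r_scale[of u "q * \<iota> - \<iota> * q"] by simp
  qed

  obtain N where N: "N \<subseteq> K" "orthonormal N"
    and N_max: "\<And>v. v \<in> K \<Longrightarrow> (\<And>z. z \<in> N \<Longrightarrow> \<langle>z | v\<rangle> = 0) \<Longrightarrow> v = 0"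
    using exists_maximal_orthonormal[of K] K(1) by metis
  \<comment> \<open>The coefficients are real on \<open>K\<close>, so the terms of the series are
    real multiples of basis vectors and stay in \<open>K\<close>.\<close>
  have exp_K: "((\<lambda>z. z \<cdot> \<langle>z | k\<rangle>) has_sum k) N" if "k \<in> K" for k
  proof (rule fourier_expansion[OF _ _ N(2) N_max that])
    fix z
    assume "z \<in> N"
    then have "\<langle>z | k\<rangle> \<in> \<real>" "z \<in> K"
      using N(1) that real_invariantD(2)[OF K(3)] by auto
    then show "z \<cdot> \<langle>z | k\<rangle> \<in> K"
      using K(1) by (auto elim!: Reals_cases simp: subspace_scale simp flip: scaleR_eq_r_scale)
  qed (use K(1) in auto)
  \<comment> \<open>By \<open>exp_K\<close> and continuity, a vector orthogonal to \<open>N\<close>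
    is orthogonal to all of \<open>K\<close>, and \<open>K_total\<close> applies.\<close>
  have exp: "((\<lambda>z. z \<cdot> \<langle>z | u\<rangle>) has_sum u) N" for u
  proof (rule fourier_expansion[OF subspace_UNIV closed_UNIV N(2)])
    fix v
    assume orth: "\<And>z. z \<in> N \<Longrightarrow> \<langle>z | v\<rangle> = 0"
    show "v = 0"
    proof (rule K_total)
      fix k
      assume "k \<in> K"
      have "\<langle>v | z\<rangle> = 0" if "z \<in> N" for z
        using orth[OF that] q_inner_eq_zero_sym by blast
      then have "((\<lambda>z. \<langle>v | z \<cdot> \<langle>z | k\<rangle>\<rangle>) has_sum 0) N"
        by (intro has_sum_0) (simp add: q_inner_r_scale_right)
      then have "\<langle>v | k\<rangle> = 0"
        using has_sum_unique q_inner_has_sum[OF exp_K[OF \<open>k \<in> K\<close>]] by blast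
      then show "\<langle>k | v\<rangle> = 0"
        using q_inner_eq_zero_sym by blast
    qed
  qed auto
  obtain L where L: "induced_left_mult N L"
    using orthonormal_induced_left_mult[OF N(2)] .
  have L_sum: "((\<lambda>z. z \<cdot> q \<cdot> \<langle>z | u\<rangle>) has_sum L q u) N"
    and L_bounded: "bounded_linear (L q)" and L_scale: "L q (u \<cdot> p) = L q u \<cdot> p" for q u p
    using L by (auto simp: induced_left_mult_def bounded_ops_def)

  \<comment> \<open>Here reality pays off: \<open>\<langle>z | k\<rangle>\<close> is central, so
    \<open>q\<close> can be moved past it and out of the series for \<open>k\<close>.\<close>
  have L_K: "L q k = k \<cdot> q" if "k \<in> K" for q k
  proof -
    have "z \<cdot> q \<cdot> \<langle>z | k\<rangle> = z \<cdot> \<langle>z | k\<rangle> \<cdot> q" if "z \<in> N" for z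
      using Reals_quat_commute[of "\<langle>z | k\<rangle>" q] real_invariantD(2)[OF K(3), of z k] N(1) that \<open>k \<in> K\<close>
      by (auto simp flip: r_scale_mult)
    then have "((\<lambda>z. z \<cdot> q \<cdot> \<langle>z | k\<rangle>) has_sum k \<cdot> q) N"
      using has_sum_bounded_linear[OF r_scale.bounded_linear_left exp_K[OF that], of q]
      by (simp cong: has_sum_cong)
    then show ?thesis
      using L_sum has_sum_unique by blast
  qed
  \<comment> \<open>As \<open>J z = z \<cdot> \<iota>\<close> on \<open>N\<close>, applying
    \<open>J\<close> to the Fourier series of \<open>u\<close> yields the defining series of
    \<open>L \<iota> u\<close>.\<close>
  have "L \<iota> u = J u" for u
  proof -
    have "((\<lambda>z. z \<cdot> \<iota> \<cdot> \<langle>z | u\<rangle>) has_sum J u) N"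
      using has_sum_bounded_linear[OF J.bounded_linear_axioms exp[of u]] JK N(1)
      by (simp add: J_scale subset_iff cong: has_sum_cong)
    then show ?thesis
      using L_sum has_sum_unique by blast
  qed
  \<comment> \<open>Invariance puts \<open>C z\<close> in \<open>K\<close>, where \<open>L q\<close>
    is right scaling by \<open>q\<close>; both sides are therefore the sum of the same
    series.\<close>
  moreover have "L q (C u) = C (L q u)" if C: "C \<in> {A, B}" for C q u
  proof -
    have C_bounded: "bounded_linear C" and C_scale: "\<And>u p. C (u \<cdot> p) = C u \<cdot> p"
      using C \<A> by (auto simp: bounded_ops_def)
    have "L q (C z) = C z \<cdot> q" if "z \<in> N" for z
      using L_K real_invariantD(1)[OF K(3) C] N(1) that by blast
    then have "((\<lambda>z. C z \<cdot> q \<cdot> \<langle>z | u\<rangle>) has_sum L q (C u)) N"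
      using has_sum_bounded_linear[OF L_bounded has_sum_bounded_linear[OF C_bounded exp[of u]], of q]
      by (simp add: C_scale L_scale cong: has_sum_cong)
    moreover have "((\<lambda>z. C z \<cdot> q \<cdot> \<langle>z | u\<rangle>) has_sum C (L q u)) N"
      using has_sum_bounded_linear[OF C_bounded L_sum[of q u]] by (simp add: C_scale)
    ultimately show ?thesis
      by (rule has_sum_unique)
  qed
  moreover have "left_scalar_mult L"
    unfolding left_scalar_mult_def
    using L hilbert_basis_if_expansion[OF N(2) exp] by blast
  ultimately show ?thesis
    by (intro exI[of _ L]) (auto simp: fun_eq_iff)
qed

end
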